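(* Let $G=C_2\wr\mathbb{Z}$ be the lamplighter group and let $X=\{(\vec{e},t),(\vec{e},t^{-1}),(\vec{a},e')\}$ be its standard generating set, where $a$ is the non-trivial element of $C_2$ and $t$ is a generator of $\mathbb{Z}$. Then $\mathrm{cr}_X(G)=0$.
   Context: For a group $G$ with finite generating set $X$, $\mathbb{B}_{G,X}(n)$ is the ball of radius $n$ about the identity for the word length over $X\cup X^{-1}$, and $C_{G,X}(n)$ is the set of conjugacy classes of $G$ having a representative in $\mathbb{B}_{G,X}(n)$. The conjugacy ratio is $\mathrm{cr}_X(G)=\limsup_{n\to\infty}\frac{|C_{G,X}(n)|}{|\mathbb{B}_{G,X}(n)|}$. For groups $H$ and $L$ with neutral elements $e$ and $e'$, the wreath product is $H\wr L=\bigoplus_{i\in L}H\rtimes L$, with multiplication $(\eta,m)(\theta,n)=(\eta\,\theta^m,mn)$, where $\theta^m(i)=\theta(m^{-1}i)$ for $i \in L$. For $h\in H$, $\vec{h}\in\bigoplus_{i\in L}H$ is the element with $\vec{h}(e')=h$ and $\vec{h}(i)=e$ for $i\neq e'$. Here $H=C_2$ and $L=\mathbb{Z}$ (written multiplicatively as $\langle t\rangle$). *)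

theory Defs
  imports "HOL-Algebra.Product_Groups" "HOL-Library.Extended_Nat" "HOL-Library.Extended_Real"
    "HOL-Library.Liminf_Limsup"
begin

definition word_value :: "('a, 'b) monoid_scheme \<Rightarrow> 'a list \<Rightarrow> 'a" where
  "word_value G ws = foldr (\<otimes>\<^bsub>G\<^esub>) ws \<one>\<^bsub>G\<^esub>"

text \<open>The length is \<open>\<infinity>\<close> for elements outside the subgroup generated by \<open>X\<close>.\<close>

definition word_length :: "('a, 'b) monoid_scheme \<Rightarrow> 'a set \<Rightarrow> 'a \<Rightarrow> enat" where
  "word_length G X g =
     (INF ws \<in> {ws. set ws \<subseteq> X \<union> (\<lambda>x. inv\<^bsub>G\<^esub> x) ` X \<and> word_value G ws = g}. enat (length ws))"

definition word_ball :: "('a, 'b) monoid_scheme \<Rightarrow> 'a set \<Rightarrow> nat \<Rightarrow> 'a set" where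
  "word_ball G X n = {g \<in> carrier G. word_length G X g \<le> enat n}"

definition conjugacy_class :: "('a, 'b) monoid_scheme \<Rightarrow> 'a \<Rightarrow> 'a set" where
  "conjugacy_class G g = {h \<otimes>\<^bsub>G\<^esub> g \<otimes>\<^bsub>G\<^esub> inv\<^bsub>G\<^esub> h | h. h \<in> carrier G}"

definition conjugacy_classes :: "('a, 'b) monoid_scheme \<Rightarrow> 'a set set" where
  "conjugacy_classes G = conjugacy_class G ` carrier G"

definition conjugacy_classes_ball ::
    "('a, 'b) monoid_scheme \<Rightarrow> 'a set \<Rightarrow> nat \<Rightarrow> 'a set set" where
  "conjugacy_classes_ball G X n = {c \<in> conjugacy_classes G. c \<inter> word_ball G X n \<noteq> {}}"

text \<open>For finite \<open>X\<close> the balls are finite and nonempty, so neither \<open>card\<close> nor the division is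
  applied outside its intended range; \<open>ereal\<close> is used because \<open>limsup\<close> needs a complete lattice.\<close>

definition conjugacy_ratio :: "('a, 'b) monoid_scheme \<Rightarrow> 'a set \<Rightarrow> ereal" where
  "conjugacy_ratio G X =
     limsup (\<lambda>n. ereal (real (card (conjugacy_classes_ball G X n)) / real (card (word_ball G X n))))"

text \<open>Elements of the direct sum \<open>sum_group\<close> are finitely supported functions on \<open>carrier L\<close> that
  take the value \<open>undefined\<close> off \<open>carrier L\<close>, hence the restricted abstractions below.\<close>

definition wreath_shift ::
    "('l, 'c) monoid_scheme \<Rightarrow> 'l \<Rightarrow> ('l \<Rightarrow> 'h) \<Rightarrow> 'l \<Rightarrow> 'h" where
  "wreath_shift L m \<theta> = (\<lambda>i \<in> carrier L. \<theta> (inv\<^bsub>L\<^esub> m \<otimes>\<^bsub>L\<^esub> i))"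

definition wreath_product ::
    "('h, 'b) monoid_scheme \<Rightarrow> ('l, 'c) monoid_scheme \<Rightarrow> (('l \<Rightarrow> 'h) \<times> 'l) monoid" where
  "wreath_product H L =
     \<lparr>carrier = carrier (sum_group (carrier L) (\<lambda>_. H)) \<times> carrier L,
      monoid.mult = (\<lambda>(\<eta>, m) (\<theta>, n).
        (\<eta> \<otimes>\<^bsub>sum_group (carrier L) (\<lambda>_. H)\<^esub> wreath_shift L m \<theta>, m \<otimes>\<^bsub>L\<^esub> n)),
      one = (\<one>\<^bsub>sum_group (carrier L) (\<lambda>_. H)\<^esub>, \<one>\<^bsub>L\<^esub>)\<rparr>"

definition wreath_vec ::
    "('h, 'b) monoid_scheme \<Rightarrow> ('l, 'c) monoid_scheme \<Rightarrow> 'h \<Rightarrow> 'l \<Rightarrow> 'h" where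
  "wreath_vec H L h = (\<lambda>i \<in> carrier L. if i = \<one>\<^bsub>L\<^esub> then h else \<one>\<^bsub>H\<^esub>)"

lemma wreath_shift_closed:
  assumes "group H" "group L" "m \<in> carrier L" "\<theta> \<in> carrier (sum_group (carrier L) (\<lambda>_. H))"
  shows "wreath_shift L m \<theta> \<in> carrier (sum_group (carrier L) (\<lambda>_. H))"
proof -
  interpret L: group L by fact
  have fin: "finite {i \<in> carrier L. \<theta> i \<noteq> \<one>\<^bsub>H\<^esub>}" and th: "\<theta> \<in> carrier L \<rightarrow>\<^sub>E carrier H"
    using assms by (auto simp: carrier_sum_group)
  have "{i \<in> carrier L. wreath_shift L m \<theta> i \<noteq> \<one>\<^bsub>H\<^esub>}
          \<subseteq> (\<lambda>j. m \<otimes>\<^bsub>L\<^esub> j) ` {i \<in> carrier L. \<theta> i \<noteq> \<one>\<^bsub>H\<^esub>}"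
  proof
    fix i assume i: "i \<in> {i \<in> carrier L. wreath_shift L m \<theta> i \<noteq> \<one>\<^bsub>H\<^esub>}"
    then have "i = m \<otimes>\<^bsub>L\<^esub> (inv\<^bsub>L\<^esub> m \<otimes>\<^bsub>L\<^esub> i)"
      using assms(3) by (simp add: L.m_assoc[symmetric])
    then show "i \<in> (\<lambda>j. m \<otimes>\<^bsub>L\<^esub> j) ` {i \<in> carrier L. \<theta> i \<noteq> \<one>\<^bsub>H\<^esub>}"
      using i assms(3) by (intro image_eqI) (auto simp: wreath_shift_def)
  qed
  then have "finite {i \<in> carrier L. wreath_shift L m \<theta> i \<noteq> \<one>\<^bsub>H\<^esub>}"
    using fin by (meson finite_imageI finite_subset)
  moreover have "wreath_shift L m \<theta> \<in> carrier L \<rightarrow>\<^sub>E carrier H"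
    using th assms(3) by (auto simp: wreath_shift_def)
  ultimately show ?thesis
    using assms(1) by (simp add: carrier_sum_group)
qed

lemma group_wreath_product:
  assumes "group H" "group L"
  shows "group (wreath_product H L)"
proof -
  interpret H: group H by fact
  interpret L: group L by fact
  let ?S = "sum_group (carrier L) (\<lambda>_. H)"
  have S: "group ?S" using assms by simp
  have car: "x i \<in> carrier H" if "x \<in> carrier ?S" "i \<in> carrier L" for x i
    using that assms by (auto simp: carrier_sum_group)
  have und: "x i = undefined" if "x \<in> carrier ?S" "i \<notin> carrier L" for x i
    using that assms by (auto simp: carrier_sum_group)
  have sh: "wreath_shift L m x \<in> carrier ?S" if "x \<in> carrier ?S" "m \<in> carrier L" for x m
    by (rule wreath_shift_closed[OF assms that(2,1)])
  show ?thesis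
  proof (rule groupI)
    fix x y assume "x \<in> carrier (wreath_product H L)" "y \<in> carrier (wreath_product H L)"
    then show "x \<otimes>\<^bsub>wreath_product H L\<^esub> y \<in> carrier (wreath_product H L)"
      using sh monoid.m_closed[OF group.is_monoid[OF S]] by (auto simp: wreath_product_def simp del: mult_sum_group)
  next
    show "\<one>\<^bsub>wreath_product H L\<^esub> \<in> carrier (wreath_product H L)"
      using monoid.one_closed[OF group.is_monoid[OF S]] by (auto simp: wreath_product_def simp del: one_sum_group)
  next
    fix x y z
    assume *: "x \<in> carrier (wreath_product H L)" "y \<in> carrier (wreath_product H L)"
      "z \<in> carrier (wreath_product H L)"
    obtain \<eta> m \<theta> n \<zeta> k where eq: "x = (\<eta>, m)" "y = (\<theta>, n)" "z = (\<zeta>, k)"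
      by (cases x, cases y, cases z) blast
    have c: "\<eta> \<in> carrier ?S" "\<theta> \<in> carrier ?S" "\<zeta> \<in> carrier ?S"
      "m \<in> carrier L" "n \<in> carrier L" "k \<in> carrier L"
      using * by (auto simp: eq wreath_product_def)
    have "(if i \<in> carrier L then \<eta> i \<otimes>\<^bsub>H\<^esub> \<theta> (inv\<^bsub>L\<^esub> m \<otimes>\<^bsub>L\<^esub> i) \<otimes>\<^bsub>H\<^esub> \<zeta> (inv\<^bsub>L\<^esub> (m \<otimes>\<^bsub>L\<^esub> n) \<otimes>\<^bsub>L\<^esub> i) else undefined)
      = (if i \<in> carrier L then \<eta> i \<otimes>\<^bsub>H\<^esub> (\<theta> (inv\<^bsub>L\<^esub> m \<otimes>\<^bsub>L\<^esub> i) \<otimes>\<^bsub>H\<^esub> \<zeta> (inv\<^bsub>L\<^esub> n \<otimes>\<^bsub>L\<^esub> (inv\<^bsub>L\<^esub> m \<otimes>\<^bsub>L\<^esub> i))) else undefined)"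
      for i
      using c by (simp add: L.inv_mult_group L.m_assoc H.m_assoc car)
    then show "x \<otimes>\<^bsub>wreath_product H L\<^esub> y \<otimes>\<^bsub>wreath_product H L\<^esub> z
        = x \<otimes>\<^bsub>wreath_product H L\<^esub> (y \<otimes>\<^bsub>wreath_product H L\<^esub> z)"
      using c by (simp add: eq wreath_product_def wreath_shift_def restrict_def L.m_assoc cong: if_cong)
  next
    fix x assume *: "x \<in> carrier (wreath_product H L)"
    obtain \<eta> m where eq: "x = (\<eta>, m)" by force
    have c: "\<eta> \<in> carrier ?S" "m \<in> carrier L" using * by (auto simp: eq wreath_product_def)
    have "wreath_shift L \<one>\<^bsub>L\<^esub> \<eta> = \<eta>"
      using und[OF c(1)] by (intro ext) (simp add: wreath_shift_def restrict_def)
    then show "\<one>\<^bsub>wreath_product H L\<^esub> \<otimes>\<^bsub>wreath_product H L\<^esub> x = x"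
      using monoid.l_one[OF group.is_monoid[OF S] c(1)] c(2)
      by (simp add: eq wreath_product_def del: mult_sum_group one_sum_group)
  next
    fix x assume x: "x \<in> carrier (wreath_product H L)"
    obtain \<eta> m where xe: "x = (\<eta>, m)" by force
    have e: "\<eta> \<in> carrier ?S" and m: "m \<in> carrier L" using x by (auto simp: xe wreath_product_def)
    let ?s = "wreath_shift L (inv\<^bsub>L\<^esub> m) \<eta>"
    have s: "?s \<in> carrier ?S" using sh e m by simp
    show "\<exists>y \<in> carrier (wreath_product H L). y \<otimes>\<^bsub>wreath_product H L\<^esub> x = \<one>\<^bsub>wreath_product H L\<^esub>"
      using s m group.l_inv[OF S s] group.inv_closed[OF S s]
      by (intro bexI[of _ "(inv\<^bsub>?S\<^esub> ?s, inv\<^bsub>L\<^esub> m)"])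
        (simp_all add: wreath_product_def xe del: mult_sum_group one_sum_group inv_sum_group)
  qed
qed

definition lamplighter_group :: "((int \<Rightarrow> int) \<times> int) monoid" where
  "lamplighter_group = wreath_product (integer_mod_group 2) integer_group"

text \<open>\<open>a\<close> is the non-trivial element of \<open>C\<^sub>2\<close> and \<open>t\<close> is a generator of \<open>\<int>\<close>.\<close>

definition lamplighter_gens :: "int \<Rightarrow> int \<Rightarrow> ((int \<Rightarrow> int) \<times> int) set" where
  "lamplighter_gens a t =
     (let vec = wreath_vec (integer_mod_group 2) integer_group;
          e = \<one>\<^bsub>integer_mod_group 2\<^esub>; e' = \<one>\<^bsub>integer_group\<^esub>
      in {(vec e, t), (vec e, inv\<^bsub>integer_group\<^esub> t), (vec a, e')})"

end

theory Submission
  imports Defs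
begin

text \<open>
  Fix \<open>K\<close>. Classes are disjoint, so those meeting the ball \<open>B(n)\<close> in at least \<open>K\<close> points number at most
  \<open>|B(n)| / K\<close>, and it suffices that the remaining, small classes are \<open>O(n)\<close> while
  \<open>|B(n)|\<close> grows at least quadratically. All rotations of a geodesic word stay in the class and in
  the ball. If the class is small, two of the first \<open>K\<close> rotations coincide, so unless the word is
  short the class contains some \<open>g \<in> B(n)\<close> commuting with a nontrivial \<open>u\<close> of length at most \<open>K\<close>. If
  \<open>u\<close> has nonzero translation part, an element of its centralizer is determined by its own
  translation part, leaving at most \<open>2 n + 1\<close> choices for \<open>g\<close>. Otherwise \<open>g\<close> lies in the base group,
  and smallness of its class confines its lamps to \<open>[-K, K]\<close>, leaving finitely many choices.
\<close>

section \<open>Words and balls\<close>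

context group
begin

lemma word_value_simps [simp]:
  "word_value G [] = \<one>" "word_value G (x # ws) = x \<otimes> word_value G ws"
  by (simp_all add: word_value_def)

lemma word_value_closed [simp, intro]:
  "set ws \<subseteq> carrier G \<Longrightarrow> word_value G ws \<in> carrier G"
  by (induction ws) auto

lemma word_value_append:
  "set us \<subseteq> carrier G \<Longrightarrow> set vs \<subseteq> carrier G \<Longrightarrow>
    word_value G (us @ vs) = word_value G us \<otimes> word_value G vs"
  by (induction us) (auto simp: m_assoc)

lemma letters_closed: "X \<subseteq> carrier G \<Longrightarrow> X \<union> (\<lambda>x. inv x) ` X \<subseteq> carrier G"
  by auto

text \<open>Since \<open>enat\<close> is well-ordered, the infimum over a nonempty set of words is
  attained; over the empty set it is \<infinity>, which no finite bound admits.\<close>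

lemma word_length_le_iff:
  "word_length G X g \<le> enat n \<longleftrightarrow>
    (\<exists>ws. set ws \<subseteq> X \<union> (\<lambda>x. inv x) ` X \<and> length ws \<le> n \<and> word_value G ws = g)"
    (is "_ \<longleftrightarrow> (\<exists>ws. ?P ws)")
proof
  let ?W = "{ws. set ws \<subseteq> X \<union> (\<lambda>x. inv x) ` X \<and> word_value G ws = g}"
  assume le: "word_length G X g \<le> enat n"
  have "?W \<noteq> {}"
  proof
    assume "?W = {}"
    then have "word_length G X g = \<infinity>"
      by (simp only: word_length_def image_empty Inf_empty top_enat_def)
    then show False
      using le by simp
  qed
  then obtain vs where "vs \<in> ?W"
    by blast
  then have "(INF ws\<in>?W. enat (length ws)) \<in> (\<lambda>ws. enat (length ws)) ` ?W"
    by (intro wellorder_InfI[of "enat (length vs)"] imageI)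
  then show "\<exists>ws. ?P ws"
    using le by (auto simp: word_length_def)
next
  assume "\<exists>ws. ?P ws"
  then obtain ws where "?P ws" ..
  then show "word_length G X g \<le> enat n"
    unfolding word_length_def by (intro INF_lower2[of ws]) auto
qed

lemma word_ball_iff:
  assumes "X \<subseteq> carrier G"
  shows "g \<in> word_ball G X n \<longleftrightarrow>
    (\<exists>ws. set ws \<subseteq> X \<union> (\<lambda>x. inv x) ` X \<and> length ws \<le> n \<and> word_value G ws = g)"
proof -
  have "word_value G ws \<in> carrier G" if "set ws \<subseteq> X \<union> (\<lambda>x. inv x) ` X" for ws
    using that letters_closed[OF assms] by (intro word_value_closed) (rule order_trans)
  then show ?thesis
    unfolding word_ball_def mem_Collect_eq word_length_le_iff by blast
qed

lemma finite_word_ball: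
  assumes "finite X" "X \<subseteq> carrier G"
  shows "finite (word_ball G X n)"
proof (rule finite_subset)
  show "word_ball G X n \<subseteq>
      word_value G ` {ws. set ws \<subseteq> X \<union> (\<lambda>x. inv x) ` X \<and> length ws \<le> n}"
    by (auto simp: word_ball_iff[OF assms(2)])
  show "finite (word_value G ` {ws. set ws \<subseteq> X \<union> (\<lambda>x. inv x) ` X \<and> length ws \<le> n})"
    using assms(1) by (intro finite_imageI finite_lists_length_le) auto
qed

text \<open>Minimal length is what later forbids a nonempty factor with trivial value: deleting it
  would leave a shorter word for the same element.\<close>

lemma geodesic_word:
  assumes "X \<subseteq> carrier G" "g \<in> word_ball G X n"
  obtains ws where "set ws \<subseteq> X \<union> (\<lambda>x. inv x) ` X" "length ws \<le> n" "word_value G ws = g"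
    "\<And>vs. set vs \<subseteq> X \<union> (\<lambda>x. inv x) ` X \<Longrightarrow> word_value G vs = g \<Longrightarrow> length ws \<le> length vs"
proof -
  let ?P = "\<lambda>ws. set ws \<subseteq> X \<union> (\<lambda>x. inv x) ` X \<and> word_value G ws = g"
  obtain us where us: "?P us" "length us \<le> n"
    using assms by (auto simp: word_ball_iff)
  define ws where "ws = arg_min length ?P"
  have "?P ws" "\<And>vs. ?P vs \<Longrightarrow> length ws \<le> length vs"
    unfolding ws_def using arg_min_nat_lemma[of ?P us length] us by blast+
  then show thesis
    using that[of ws] us order_trans[of "length ws" "length us" n] by blast
qed

section \<open>Conjugacy classes\<close>

lemma conjugacy_class_self: "g \<in> carrier G \<Longrightarrow> g \<in> conjugacy_class G g"
  unfolding conjugacy_class_def by (intro CollectI exI[of _ \<one>]) simp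

lemma conjugacy_class_subset:
  assumes "g \<in> carrier G" "h \<in> conjugacy_class G g"
  shows "conjugacy_class G h \<subseteq> conjugacy_class G g"
proof
  fix x assume "x \<in> conjugacy_class G h"
  then obtain k l where kl: "k \<in> carrier G" "l \<in> carrier G"
    and "x = k \<otimes> (l \<otimes> g \<otimes> inv l) \<otimes> inv k"
    using assms(2) by (auto simp: conjugacy_class_def)
  then have "x = (k \<otimes> l) \<otimes> g \<otimes> inv (k \<otimes> l)"
    using assms(1) by (simp add: m_assoc inv_mult_group)
  then show "x \<in> conjugacy_class G g"
    using kl unfolding conjugacy_class_def by blast
qed

lemma conjugacy_class_eq:
  assumes "g \<in> carrier G" "h \<in> conjugacy_class G g"
  shows "conjugacy_class G h = conjugacy_class G g"
proof
  obtain k where k: "k \<in> carrier G" "h = k \<otimes> g \<otimes> inv k"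
    using assms(2) by (auto simp: conjugacy_class_def)
  have "g = inv k \<otimes> h \<otimes> inv (inv k)"
    using assms(1) k by (simp add: m_assoc) (simp flip: m_assoc)
  then have "g \<in> conjugacy_class G h"
    using k(1) unfolding conjugacy_class_def by blast
  then show "conjugacy_class G g \<subseteq> conjugacy_class G h"
    using assms(1) k by (intro conjugacy_class_subset) auto
qed (rule conjugacy_class_subset[OF assms])

lemma conjugacy_class_of_mem:
  assumes "c \<in> conjugacy_classes G" "g \<in> c"
  shows "c = conjugacy_class G g"
  using assms conjugacy_class_eq by (auto simp: conjugacy_classes_def)

lemma conjugacy_classes_ball_image:
  "conjugacy_classes_ball G X n = conjugacy_class G ` word_ball G X n"
proof
  show "conjugacy_classes_ball G X n \<subseteq> conjugacy_class G ` word_ball G X n"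
    unfolding conjugacy_classes_ball_def using conjugacy_class_of_mem by blast
  show "conjugacy_class G ` word_ball G X n \<subseteq> conjugacy_classes_ball G X n"
    unfolding conjugacy_classes_ball_def conjugacy_classes_def
    using conjugacy_class_self by (auto simp: word_ball_def)
qed

section \<open>Rotations of words and the size of classes\<close>

text \<open>For prefix value u and suffix value v this is u^-1 (u v) u = v u: moving a prefix to the
  end is a conjugation.\<close>

lemma conjugate_by_prefix:
  assumes "set (us @ vs) \<subseteq> carrier G"
  shows "inv (word_value G us) \<otimes> word_value G (us @ vs) \<otimes> word_value G us = word_value G (vs @ us)"
proof -
  have "word_value G us \<in> carrier G" "word_value G vs \<in> carrier G"
    using assms by auto
  moreover from this have "inv (word_value G us) \<otimes> (word_value G us \<otimes> word_value G vs) = word_value G vs"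
    by (simp flip: m_assoc)
  ultimately show ?thesis
    using assms by (simp add: word_value_append)
qed

lemma rotation_in_class_ball:
  assumes X: "X \<subseteq> carrier G" and c: "c \<in> conjugacy_classes G"
    and ws: "set (us @ vs) \<subseteq> X \<union> (\<lambda>x. inv x) ` X" "length (us @ vs) \<le> n" "word_value G (us @ vs) \<in> c"
  shows "word_value G (vs @ us) \<in> c \<inter> word_ball G X n"
proof
  have car: "set (us @ vs) \<subseteq> carrier G"
    using ws(1) letters_closed[OF X] by blast
  then have u: "word_value G us \<in> carrier G"
    by auto
  have "word_value G (vs @ us) =
      inv (word_value G us) \<otimes> word_value G (us @ vs) \<otimes> inv (inv (word_value G us))"
    using conjugate_by_prefix[OF car] u by simp
  then have "word_value G (vs @ us) \<in> conjugacy_class G (word_value G (us @ vs))"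
    using inv_closed[OF u] unfolding conjugacy_class_def by blast
  then show "word_value G (vs @ us) \<in> c"
    using conjugacy_class_of_mem[OF c ws(3)] by simp
  show "word_value G (vs @ us) \<in> word_ball G X n"
    unfolding word_ball_iff[OF X] using ws by (intro exI[of _ "vs @ us"]) auto
qed

text \<open>Distinct classes are disjoint, so each class with at least \<open>K\<close> points in
  the ball uses up \<open>K\<close> ball elements of its own. The other classes are merely counted
  here and bounded later.\<close>

lemma card_conjugacy_classes_ball_le:
  assumes "finite X" "X \<subseteq> carrier G"
  shows "K * card (conjugacy_classes_ball G X n) \<le> card (word_ball G X n) +
    K * card {c \<in> conjugacy_classes_ball G X n. card (c \<inter> word_ball G X n) < K}"
proof -
  let ?B = "word_ball G X n" and ?C = "conjugacy_classes_ball G X n"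
  let ?bad = "{c \<in> ?C. card (c \<inter> ?B) < K}"
  have finB: "finite ?B" by (rule finite_word_ball[OF assms])
  then have finC: "finite ?C" by (simp add: conjugacy_classes_ball_image)
  have "K * card (?C - ?bad) = (\<Sum>c\<in>?C - ?bad. K)" by simp
  also have "\<dots> \<le> (\<Sum>c\<in>?C - ?bad. card (c \<inter> ?B))"
    by (intro sum_mono) auto
  also have "\<dots> = card (\<Union>c\<in>?C - ?bad. c \<inter> ?B)"
  proof (rule card_UN_disjoint[symmetric])
    show "\<forall>c\<in>?C - ?bad. \<forall>d\<in>?C - ?bad. c \<noteq> d \<longrightarrow> c \<inter> ?B \<inter> (d \<inter> ?B) = {}"
      unfolding conjugacy_classes_ball_def using conjugacy_class_of_mem by blast
  qed (use finB finC in auto)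
  also have "\<dots> \<le> card ?B"
    by (intro card_mono finB) auto
  finally have "K * card (?C - ?bad) \<le> card ?B" .
  moreover have "card ?C = card (?C - ?bad) + card ?bad"
    using finC card_mono[OF finC, of ?bad] by (subst card_Diff_subset) auto
  ultimately show ?thesis
    by (simp add: algebra_simps)
qed

text \<open>Two equal rotations of a geodesic word differ by a nontrivial factor of the word, which
  commutes with their common value.\<close>

lemma small_class_commutes:
  assumes X: "finite X" "X \<subseteq> carrier G"
    and c: "c \<in> conjugacy_classes_ball G X n" "card (c \<inter> word_ball G X n) < K"
    and large: "c \<notin> conjugacy_classes_ball G X K"
  obtains u g where "u \<in> word_ball G X K" "u \<noteq> \<one>" "g \<in> c \<inter> word_ball G X n" "u \<otimes> g = g \<otimes> u"
proof -
  let ?A = "X \<union> (\<lambda>x. inv x) ` X"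
  have cc: "c \<in> conjugacy_classes G" and "c \<inter> word_ball G X n \<noteq> {}"
    using c(1) unfolding conjugacy_classes_ball_def by blast+
  then obtain g where g: "g \<in> c" "g \<in> word_ball G X n" by blast
  obtain ws where ws: "set ws \<subseteq> ?A" "length ws \<le> n" "word_value G ws = g"
    and geo: "\<And>vs. set vs \<subseteq> ?A \<Longrightarrow> word_value G vs = g \<Longrightarrow> length ws \<le> length vs"
    using geodesic_word[OF X(2) g(2)] by metis
  \<comment> \<open>A word of at most \<open>K\<close> letters would make \<open>c\<close> meet the
    ball of radius \<open>K\<close>. Hence all cut positions below \<open>K\<close> lie strictly
    before the end of \<open>ws\<close>.\<close>
  have "\<not> length ws \<le> K"
  proof
    assume "length ws \<le> K"
    then have "g \<in> word_ball G X K"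
      using ws by (auto simp: word_ball_iff[OF X(2)])
    then show False
      using g(1) cc large by (auto simp: conjugacy_classes_ball_def)
  qed
  define r where "r i = word_value G (drop i ws @ take i ws)" for i
  have r: "r i \<in> c \<inter> word_ball G X n" for i
    unfolding r_def using ws g by (intro rotation_in_class_ball X cc) auto
  \<comment> \<open>Pigeonhole: \<open>K\<close> rotations lie in a set with fewer than
    \<open>K\<close> elements.\<close>
  have "card (r ` {..<K}) \<le> card (c \<inter> word_ball G X n)"
    using r finite_word_ball[OF X] by (intro card_mono) auto
  with c(2) have "\<not> inj_on r {..<K}"
    using card_image by fastforce
  then obtain i j where ij: "i < j" "j < K" "r i = r j"
    unfolding inj_on_def by (metis lessThan_iff linorder_neq_iff)
  \<comment> \<open>\<open>b\<close> is the factor between the two cuts, so that \<open>r i\<close>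
    is the value of \<open>b d a\<close> and \<open>r j\<close> that of
    \<open>d a b\<close>.\<close>
  define a b d where "a = take i ws" and "b = drop i (take j ws)" and "d = drop j ws"
  have len: "length a = i" "length b = j - i"
    using ij \<open>\<not> length ws \<le> K\<close> by (simp_all add: a_def b_def)
  have eq1: "take j ws = a @ b"
    using append_take_drop_id[of i "take j ws"] ij by (simp add: a_def b_def min_def)
  then have eq3: "ws = a @ b @ d"
    using append_take_drop_id[of j ws] by (simp add: d_def)
  then have eq2: "drop i ws = b @ d"
    using len by simp
  have sub: "set a \<subseteq> ?A" "set b \<subseteq> ?A" "set d \<subseteq> ?A"
    using ws(1) eq3 by auto
  then have car: "set a \<subseteq> carrier G" "set b \<subseteq> carrier G" "set d \<subseteq> carrier G"
    using letters_closed[OF X(2)] by blast+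
  let ?u = "word_value G b"
  \<comment> \<open>Both sides are the value of \<open>b d a b\<close>; with
    \<open>r i = r j\<close> this becomes commutation.\<close>
  have "?u \<otimes> r j = r i \<otimes> ?u"
    using car by (simp add: r_def eq1 eq2 d_def[symmetric] a_def[symmetric] word_value_append m_assoc)
  then have "?u \<otimes> r i = r i \<otimes> ?u"
    by (simp add: ij)
  moreover have "?u \<noteq> \<one>"
  proof
    assume "?u = \<one>"
    then have "word_value G (a @ d) = g"
      using car ws(3) by (simp add: eq3 word_value_append)
    with geo[of "a @ d"] sub len ij show False
      by (simp add: eq3)
  qed
  moreover have "?u \<in> word_ball G X K"
    unfolding word_ball_iff[OF X(2)] using sub len ij by (intro exI[of _ b]) auto
  ultimately show thesis
    using that r by blast
qed

end

section \<open>The lamplighter group\<close>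

interpretation L: group lamplighter_group
  unfolding lamplighter_group_def by (intro group_wreath_product) simp_all

section \<open>Coordinates, generators and balls\<close>

text \<open>The carrier of \<open>integer_group\<close> is the whole type, so the restricted
  functions of the direct sum are ordinary total functions, here with values in the residues 0 and
  1.\<close>

lemma carrier_lamplighter:
  "carrier lamplighter_group = {\<eta>. range \<eta> \<subseteq> {0..<2} \<and> finite {i. \<eta> i \<noteq> 0}} \<times> UNIV"
  by (auto simp: lamplighter_group_def wreath_product_def carrier_sum_group carrier_integer_mod_group)

lemma one_lamplighter: "\<one>\<^bsub>lamplighter_group\<^esub> = (\<lambda>_. 0, 0)"
  by (auto simp: lamplighter_group_def wreath_product_def)

lemma mult_lamplighter:
  "(\<eta>, m) \<otimes>\<^bsub>lamplighter_group\<^esub> (\<theta>, n) = (\<lambda>i. (\<eta> i + \<theta> (i - m)) mod 2, m + n)"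
  by (simp add: lamplighter_group_def wreath_product_def wreath_shift_def restrict_def)

lemma fst_mult_lamplighter:
  "fst (g \<otimes>\<^bsub>lamplighter_group\<^esub> h) i = (fst g i + fst h (i - snd g)) mod 2"
  by (cases g; cases h) (simp add: mult_lamplighter)

lemma snd_mult_lamplighter: "snd (g \<otimes>\<^bsub>lamplighter_group\<^esub> h) = snd g + snd h"
  by (cases g; cases h) (simp add: mult_lamplighter)

lemma lamp_values:
  assumes "g \<in> carrier lamplighter_group"
  shows "fst g i = 0 \<or> fst g i = 1"
proof -
  have "range (fst g) \<subseteq> {0..<2}"
    using assms by (auto simp: carrier_lamplighter)
  then have "fst g i \<in> {0..<2}" by blast
  then show ?thesis by auto
qed

lemma finite_lamps: "g \<in> carrier lamplighter_group \<Longrightarrow> finite {i. fst g i \<noteq> 0}"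
  by (auto simp: carrier_lamplighter)

definition lamp :: "int \<Rightarrow> int \<Rightarrow> int" where
  "lamp i j = (if j = i then 1 else 0)"

text \<open>The standard generating set in coordinates. It is the same for \<open>t = 1\<close> and
  \<open>t = -1\<close>, as it contains the moves in both directions.\<close>

definition lamp_letters :: "((int \<Rightarrow> int) \<times> int) set" where
  "lamp_letters = {(\<lambda>_. 0, 1), (\<lambda>_. 0, -1), (lamp 0, 0)}"

lemma lamp_letters_closed: "lamp_letters \<subseteq> carrier lamplighter_group"
  by (auto simp: lamp_letters_def carrier_lamplighter lamp_def)

text \<open>The two moves are inverse to each other and the switch is an involution, so words need
  no formal inverses.\<close>

lemma letters_lamp_letters:
  "lamp_letters \<union> (\<lambda>x. inv\<^bsub>lamplighter_group\<^esub> x) ` lamp_letters = lamp_letters"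
proof -
  have "inv\<^bsub>lamplighter_group\<^esub> (\<lambda>_. 0, 1) = (\<lambda>_. 0, -1)"
    by (rule L.inv_equality) (auto simp: mult_lamplighter one_lamplighter carrier_lamplighter)
  moreover have "inv\<^bsub>lamplighter_group\<^esub> (\<lambda>_. 0, -1) = (\<lambda>_. 0, 1)"
    by (rule L.inv_equality) (auto simp: mult_lamplighter one_lamplighter carrier_lamplighter)
  moreover have "inv\<^bsub>lamplighter_group\<^esub> (lamp 0, 0) = (lamp 0, 0)"
    by (rule L.inv_equality)
      (auto simp: mult_lamplighter one_lamplighter carrier_lamplighter lamp_def)
  ultimately show ?thesis
    unfolding lamp_letters_def by (simp only: image_insert image_empty) blast
qed

text \<open>The multiples of \<open>t\<close> form a subgroup containing \<open>t\<close>, hence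
  everything; so 1 is a multiple of \<open>t\<close> and \<open>t\<close> is a unit.\<close>

lemma generator_integer_group:
  assumes "generate integer_group {t} = carrier integer_group"
  shows "t = 1 \<or> t = -1"
proof -
  have "subgroup (range (\<lambda>k. t * k)) integer_group"
  proof (rule group.subgroupI[OF group_integer_group])
    fix x y assume "x \<in> range (\<lambda>k. t * k)" "y \<in> range (\<lambda>k. t * k)"
    then obtain k l where "x = t * k" "y = t * l" by blast
    then show "inv\<^bsub>integer_group\<^esub> x \<in> range (\<lambda>k. t * k)"
      and "x \<otimes>\<^bsub>integer_group\<^esub> y \<in> range (\<lambda>k. t * k)"
      by (auto intro: range_eqI[of _ _ "- k"] range_eqI[of _ _ "k + l"] simp: algebra_simps)
  qed auto
  moreover have "t \<in> range (\<lambda>k. t * k)"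
    by (rule range_eqI[of _ _ 1]) simp
  ultimately have "generate integer_group {t} \<subseteq> range (\<lambda>k. t * k)"
    by (intro group.generate_subgroup_incl[OF group_integer_group]) auto
  then have "1 \<in> range (\<lambda>k. t * k)"
    using assms by auto
  then show ?thesis
    by (metis imageE zmult_eq_1_iff)
qed

lemma lamplighter_gens_eq:
  assumes "a \<in> carrier (integer_mod_group 2)" "a \<noteq> \<one>\<^bsub>integer_mod_group 2\<^esub>"
    and "generate integer_group {t} = carrier integer_group"
  shows "lamplighter_gens a t = lamp_letters"
proof -
  have "a = 1"
    using assms(1,2) by (auto simp: carrier_integer_mod_group)
  moreover have "wreath_vec (integer_mod_group 2) integer_group 1 = lamp 0"
    "wreath_vec (integer_mod_group 2) integer_group 0 = (\<lambda>_. 0)"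
    by (auto simp: wreath_vec_def lamp_def)
  ultimately show ?thesis
    using generator_integer_group[OF assms(3)]
    by (auto simp: lamplighter_gens_def lamp_letters_def)
qed

lemma lamplighter_ball_iff:
  "g \<in> word_ball lamplighter_group lamp_letters n \<longleftrightarrow>
    (\<exists>ws. set ws \<subseteq> lamp_letters \<and> length ws \<le> n \<and> word_value lamplighter_group ws = g)"
  using L.word_ball_iff[OF lamp_letters_closed] by (simp add: letters_lamp_letters)

lemma finite_lamplighter_ball: "finite (word_ball lamplighter_group lamp_letters n)"
  by (intro L.finite_word_ball lamp_letters_closed) (simp add: lamp_letters_def)

lemma lamplighter_word_closed:
  "set ws \<subseteq> lamp_letters \<Longrightarrow> set ws \<subseteq> carrier lamplighter_group"
  using lamp_letters_closed by blast

section \<open>Words as walks along the lamps\<close>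

lemma abs_snd_word_le:
  "set ws \<subseteq> lamp_letters \<Longrightarrow> \<bar>snd (word_value lamplighter_group ws)\<bar> \<le> int (length ws)"
  by (induction ws) (auto simp: one_lamplighter snd_mult_lamplighter lamp_letters_def)

text \<open>A letter can switch only the lamp at the current position, which is the translation part
  of the prefix read so far. Induction from the right exposes the last letter together with this
  prefix.\<close>

lemma lit_lamp_visited:
  "set ws \<subseteq> lamp_letters \<Longrightarrow> fst (word_value lamplighter_group ws) i \<noteq> 0 \<Longrightarrow>
    \<exists>j\<le>length ws. snd (word_value lamplighter_group (take j ws)) = i"
proof (induction ws rule: rev_induct)
  case Nil
  then show ?case by (simp add: one_lamplighter)
next
  case (snoc x ws)
  let ?g = "word_value lamplighter_group ws"
  have x: "x \<in> lamp_letters" and ws: "set ws \<subseteq> lamp_letters"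
    using snoc.prems by auto
  have "word_value lamplighter_group (ws @ [x]) = ?g \<otimes>\<^bsub>lamplighter_group\<^esub> x"
    using x lamplighter_word_closed[OF ws] lamp_letters_closed
    by (subst L.word_value_append) auto
  with snoc.prems(2) have "fst ?g i \<noteq> 0 \<or> fst x (i - snd ?g) \<noteq> 0"
    by (auto simp: fst_mult_lamplighter)
  then show ?case
  proof
    assume "fst ?g i \<noteq> 0"
    with snoc.IH[OF ws] obtain j where "j \<le> length ws" "snd (word_value lamplighter_group (take j ws)) = i"
      by blast
    then show ?thesis
      by (intro exI[of _ j]) simp
  next
    assume "fst x (i - snd ?g) \<noteq> 0"
    then have "snd ?g = i"
      using x by (auto simp: lamp_letters_def lamp_def split: if_splits)
    then show ?thesis
      by (intro exI[of _ "length ws"]) simp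
  qed
qed

text \<open>The walk starts at 0 and each letter moves it by at most one, so it cannot jump over an
  integer.\<close>

lemma intermediate_position_visited:
  assumes ws: "set ws \<subseteq> lamp_letters" and j: "j \<le> length ws"
    and i: "snd (word_value lamplighter_group (take j ws)) = i" and k: "k \<in> {min 0 i..max 0 i}"
  shows "\<exists>j'. snd (word_value lamplighter_group (take j' ws)) = k"
proof -
  define f where "f j = snd (word_value lamplighter_group (take j ws))" for j
  have step: "\<bar>f (l + 1) - f l\<bar> \<le> 1" if "l < j" for l
  proof -
    have x: "ws ! l \<in> lamp_letters"
      using ws j that nth_mem[of l ws] by fastforce
    have "set (take l ws) \<subseteq> carrier lamplighter_group"
      using lamplighter_word_closed[OF ws] set_take_subset by fast
    then have "f (l + 1) = f l + snd (ws ! l)"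
      using x lamp_letters_closed j that
      by (auto simp: f_def take_Suc_conv_app_nth L.word_value_append snd_mult_lamplighter)
    then show ?thesis
      using x by (auto simp: lamp_letters_def)
  qed
  have f: "f 0 = 0" "f j = i"
    using i by (simp_all add: f_def one_lamplighter)
  show ?thesis
  proof (cases "0 \<le> i")
    case True
    then show ?thesis
      using nat0_intermed_int_val[of j f k] step f k by (auto simp: f_def)
  next
    case False
    \<comment> \<open>The discrete intermediate value theorem climbs from \<open>f 0\<close>; a walk
      to the left is reflected first.\<close>
    then have "\<exists>l\<le>j. - f l = - k"
      using step f k by (intro nat0_intermed_int_val) (force simp: abs_minus_commute)+
    then show ?thesis
      by (auto simp: f_def)
  qed
qed

section \<open>Shifts of finite sets and conjugates of base elements\<close>

text \<open>For positive \<open>m\<close> the minimum of \<open>D\<close> would be moved below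
  itself, for negative \<open>m\<close> the maximum above itself.\<close>

lemma finite_shift_stable:
  fixes D :: "int set"
  assumes "finite D" "D \<noteq> {}" "\<And>i. i \<in> D \<Longrightarrow> i - m \<in> D"
  shows "m = 0"
  using assms(3)[OF Min_in[OF assms(1,2)]] assms(3)[OF Max_in[OF assms(1,2)]]
    Min_le[OF assms(1)] Max_ge[OF assms(1)] by fastforce

text \<open>The base group is abelian, so the lamps of \<open>P\<close> cancel and only its
  translation part acts.\<close>

lemma conjugate_base:
  assumes P: "P \<in> carrier lamplighter_group" and g: "(\<eta>, 0) \<in> carrier lamplighter_group"
  shows "inv\<^bsub>lamplighter_group\<^esub> P \<otimes>\<^bsub>lamplighter_group\<^esub> (\<eta>, 0) \<otimes>\<^bsub>lamplighter_group\<^esub> P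
    = (\<lambda>i. \<eta> (i + snd P), 0)"
proof -
  let ?X = "(\<lambda>i. \<eta> (i + snd P), 0 :: int)"
  have "{i. \<eta> (i + snd P) \<noteq> 0} = (\<lambda>i. i - snd P) ` {i. \<eta> i \<noteq> 0}"
    by force
  then have X: "?X \<in> carrier lamplighter_group"
    using g by (auto simp: carrier_lamplighter)
  \<comment> \<open>Comparing these two products avoids an explicit formula for the inverse of
    \<open>P\<close>.\<close>
  have "(\<eta>, 0) \<otimes>\<^bsub>lamplighter_group\<^esub> P = P \<otimes>\<^bsub>lamplighter_group\<^esub> ?X"
    by (cases P) (simp add: mult_lamplighter add.commute)
  then have "?X = inv\<^bsub>lamplighter_group\<^esub> P \<otimes>\<^bsub>lamplighter_group\<^esub> ((\<eta>, 0) \<otimes>\<^bsub>lamplighter_group\<^esub> P)"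
    using P g X by (simp add: L.inv_solve_left)
  then show ?thesis
    using P g by (simp add: L.m_assoc)
qed

text \<open>A word for a base element visits every position between the origin and a lit lamp, and the
  rotations of the word at these positions are different translates of the configuration.\<close>

lemma small_base_class_support:
  assumes c: "c \<in> conjugacy_classes lamplighter_group"
    and g: "(\<zeta>, 0) \<in> c \<inter> word_ball lamplighter_group lamp_letters n"
    and small: "card (c \<inter> word_ball lamplighter_group lamp_letters n) < K"
    and i: "\<zeta> i \<noteq> 0"
  shows "\<bar>i\<bar> < int K"
proof -
  let ?B = "word_ball lamplighter_group lamp_letters n"
  let ?I = "{min 0 i..max 0 i}"
  define f where "f k = (\<lambda>l. \<zeta> (l + k), 0 :: int)" for k
  obtain ws where ws: "set ws \<subseteq> lamp_letters" "length ws \<le> n"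
    "word_value lamplighter_group ws = (\<zeta>, 0)"
    using g by (auto simp: lamplighter_ball_iff)
  have car: "set ws \<subseteq> carrier lamplighter_group"
    by (rule lamplighter_word_closed[OF ws(1)])
  have gcar: "(\<zeta>, 0) \<in> carrier lamplighter_group"
    using L.word_value_closed[OF car] ws(3) by simp
  obtain j where j: "j \<le> length ws" "snd (word_value lamplighter_group (take j ws)) = i"
    using lit_lamp_visited[OF ws(1), of i] ws(3) i by auto
  have "f k \<in> c \<inter> ?B" if k: "k \<in> ?I" for k
  proof -
    obtain j' where j': "snd (word_value lamplighter_group (take j' ws)) = k"
      using intermediate_position_visited[OF ws(1) j k] by blast
    let ?P = "word_value lamplighter_group (take j' ws)"
    have P: "?P \<in> carrier lamplighter_group"
      using car set_take_subset by (intro L.word_value_closed) fast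
    have "word_value lamplighter_group (drop j' ws @ take j' ws) = f k"
      using L.conjugate_by_prefix[of "take j' ws" "drop j' ws"] car conjugate_base[OF P gcar] j' ws(3)
      by (simp add: f_def)
    moreover have "word_value lamplighter_group (drop j' ws @ take j' ws) \<in> c \<inter> ?B"
      by (rule L.rotation_in_class_ball[OF lamp_letters_closed c])
        (use ws g letters_lamp_letters in auto)
    ultimately show ?thesis by simp
  qed
  then have "card (f ` ?I) \<le> card (c \<inter> ?B)"
    using finite_lamplighter_ball by (intro card_mono) auto
  moreover have "inj_on f ?I"
  proof (rule inj_onI)
    fix k k' assume "f k = f k'"
    then have eq: "\<zeta> (l + k) = \<zeta> (l + k')" for l
      by (simp add: f_def fun_eq_iff)
    \<comment> \<open>Equal translates make the finite nonempty set of lit lamps stable under the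
      shift by \<open>k - k'\<close>.\<close>
    have "k - k' = 0"
    proof (rule finite_shift_stable)
      show "finite {i. \<zeta> i \<noteq> 0}" "{i. \<zeta> i \<noteq> 0} \<noteq> {}"
        using finite_lamps[OF gcar] i by auto
      show "l - (k - k') \<in> {i. \<zeta> i \<noteq> 0}" if "l \<in> {i. \<zeta> i \<noteq> 0}" for l
        using that eq[of "l - k"] by (simp add: algebra_simps)
    qed
    then show "k = k'" by simp
  qed
  then have "card (f ` ?I) = nat (\<bar>i\<bar> + 1)"
    by (simp add: card_image)
  ultimately show ?thesis
    using small by linarith
qed

section \<open>Centralizers\<close>

text \<open>Reading \<open>u g = g u\<close> at lamp \<open>i\<close> determines \<open>g\<close> at
  \<open>i\<close> from \<open>g\<close> at \<open>i - snd u\<close>, from \<open>u\<close> and from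
  \<open>snd g\<close>. So if \<open>g\<close> and \<open>h\<close> have equal translation parts and
  differ at \<open>i\<close>, they differ at \<open>i - snd u\<close> too; a finite set stable under
  a nonzero shift is empty.\<close>

lemma inj_on_snd_centralizer:
  assumes "snd u \<noteq> 0"
  shows "inj_on snd {g \<in> carrier lamplighter_group.
    u \<otimes>\<^bsub>lamplighter_group\<^esub> g = g \<otimes>\<^bsub>lamplighter_group\<^esub> u}"
proof (rule inj_onI)
  fix g h
  assume "g \<in> {g \<in> carrier lamplighter_group. u \<otimes>\<^bsub>lamplighter_group\<^esub> g = g \<otimes>\<^bsub>lamplighter_group\<^esub> u}"
    and "h \<in> {g \<in> carrier lamplighter_group. u \<otimes>\<^bsub>lamplighter_group\<^esub> g = g \<otimes>\<^bsub>lamplighter_group\<^esub> u}"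
    and snd: "snd g = snd h"
  then have g: "g \<in> carrier lamplighter_group" "u \<otimes>\<^bsub>lamplighter_group\<^esub> g = g \<otimes>\<^bsub>lamplighter_group\<^esub> u"
    and h: "h \<in> carrier lamplighter_group" "u \<otimes>\<^bsub>lamplighter_group\<^esub> h = h \<otimes>\<^bsub>lamplighter_group\<^esub> u"
    by auto
  let ?D = "{i. fst g i \<noteq> fst h i}"
  have "finite ?D"
    by (rule finite_subset[OF _ finite_UnI[OF finite_lamps[OF g(1)] finite_lamps[OF h(1)]]]) auto
  moreover have "i - snd u \<in> ?D" if "i \<in> ?D" for i
  proof (intro CollectI notI)
    assume "fst g (i - snd u) = fst h (i - snd u)"
    moreover have "(fst u i + fst g (i - snd u)) mod 2 = (fst g i + fst u (i - snd g)) mod 2"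
      using arg_cong[OF g(2), of "\<lambda>x. fst x i"] by (simp add: fst_mult_lamplighter)
    moreover have "(fst u i + fst h (i - snd u)) mod 2 = (fst h i + fst u (i - snd g)) mod 2"
      using arg_cong[OF h(2), of "\<lambda>x. fst x i"] snd by (simp add: fst_mult_lamplighter)
    ultimately have "(fst g i + fst u (i - snd g)) mod 2 = (fst h i + fst u (i - snd g)) mod 2"
      by simp
    then have "fst g i mod 2 = fst h i mod 2"
      by presburger
    then have "fst g i = fst h i"
      using lamp_values[OF g(1), of i] lamp_values[OF h(1), of i] by auto
    then show False
      using that by simp
  qed
  ultimately have "?D = {}"
    using finite_shift_stable[of ?D "snd u"] assms by blast
  then show "g = h"
    using snd by (auto simp: prod_eq_iff fun_eq_iff)
qed

text \<open>Translation parts of ball elements lie between \<open>-n\<close> and \<open>n\<close>,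
  and \<open>snd\<close> is injective on the centralizer.\<close>

lemma card_centralizer_ball_le:
  assumes "snd u \<noteq> 0"
  shows "card {g \<in> word_ball lamplighter_group lamp_letters n.
    u \<otimes>\<^bsub>lamplighter_group\<^esub> g = g \<otimes>\<^bsub>lamplighter_group\<^esub> u} \<le> 2 * n + 1" (is "card ?Z \<le> _")
proof -
  have "inj_on snd ?Z"
    by (rule inj_on_subset[OF inj_on_snd_centralizer[OF assms]]) (auto simp: word_ball_def)
  moreover have "snd ` ?Z \<subseteq> {- int n..int n}"
    using abs_snd_word_le by (fastforce simp: lamplighter_ball_iff)
  ultimately have "card ?Z \<le> card {- int n..int n}"
    by (intro card_inj_on_le) auto
  then show ?thesis by simp
qed

text \<open>Commutation makes the lit lamps of \<open>u\<close>, a finite nonempty set, stable under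
  the shift by \<open>snd g\<close>.\<close>

lemma commuting_with_base:
  assumes u: "u \<in> carrier lamplighter_group" "snd u = 0" "u \<noteq> \<one>\<^bsub>lamplighter_group\<^esub>"
    and comm: "u \<otimes>\<^bsub>lamplighter_group\<^esub> g = g \<otimes>\<^bsub>lamplighter_group\<^esub> u"
  shows "snd g = 0"
proof (rule finite_shift_stable[OF finite_lamps[OF u(1)]])
  show "{i. fst u i \<noteq> 0} \<noteq> {}"
    using u(2,3) by (auto simp: one_lamplighter prod_eq_iff)
  show "i - snd g \<in> {i. fst u i \<noteq> 0}" if "i \<in> {i. fst u i \<noteq> 0}" for i
  proof (intro CollectI notI)
    \<comment> \<open>As \<open>snd u = 0\<close>, the same value of \<open>g\<close> occurs on both
      sides and cancels modulo 2.\<close>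
    have "(fst u i + fst g i) mod 2 = (fst g i + fst u (i - snd g)) mod 2"
      using arg_cong[OF comm, of "\<lambda>x. fst x i"] u(2) by (simp add: fst_mult_lamplighter)
    moreover assume "fst u (i - snd g) = 0"
    ultimately have "fst u i mod 2 = 0"
      by presburger
    then show False
      using that lamp_values[OF u(1), of i] by auto
  qed
qed

section \<open>A linear bound for the number of small classes\<close>

text \<open>Small classes fall into three families: those meeting the ball of radius
  \<open>K\<close>, those of base elements with lamps in \<open>[-K, K]\<close>, and those of ball
  elements commuting with some \<open>u\<close> of length at most \<open>K\<close> and nonzero
  translation part. The first two do not grow with \<open>n\<close>; in the third each of the
  finitely many \<open>u\<close> contributes at most \<open>2 * n + 1\<close>.\<close>

lemma card_small_classes_le:
  "\<exists>D. \<forall>n. card {c \<in> conjugacy_classes_ball lamplighter_group lamp_letters n.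
      card (c \<inter> word_ball lamplighter_group lamp_letters n) < K} \<le> D * (2 * n + 1)"
proof -
  let ?G = lamplighter_group
  let ?B = "word_ball ?G lamp_letters" and ?C = "conjugacy_classes_ball ?G lamp_letters"
  define E where "E = {g \<in> carrier ?G. snd g = 0 \<and> {i. fst g i \<noteq> 0} \<subseteq> {- int K..int K}}"
  define U where "U = {u \<in> ?B K. snd u \<noteq> 0}"
  define Z where "Z n u = {g \<in> ?B n. u \<otimes>\<^bsub>?G\<^esub> g = g \<otimes>\<^bsub>?G\<^esub> u}" for n u
  \<comment> \<open>An element of \<open>E\<close> is determined by its set of lit lamps, a subset
    of a finite interval.\<close>
  have "E \<subseteq> (\<lambda>A. (\<lambda>i. if i \<in> A then 1 else 0, 0)) ` Pow {- int K..int K}"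
  proof
    fix g assume g: "g \<in> E"
    then have "g = (\<lambda>i. if i \<in> {i. fst g i \<noteq> 0} then 1 else 0, 0)"
      using lamp_values[of g] by (auto simp: E_def prod_eq_iff fun_eq_iff)
    with g show "g \<in> (\<lambda>A. (\<lambda>i. if i \<in> A then 1 else 0, 0)) ` Pow {- int K..int K}"
      unfolding E_def by blast
  qed
  then have finE: "finite E"
    by (rule finite_subset) simp
  have finU: "finite U" and finZ: "finite (Z n u)" for n u
    using finite_lamplighter_ball by (auto simp: U_def Z_def)
  have finC: "finite (?C K)"
    by (simp add: L.conjugacy_classes_ball_image finite_lamplighter_ball)
  have sub: "{c \<in> ?C n. card (c \<inter> ?B n) < K}
      \<subseteq> ?C K \<union> (conjugacy_class ?G ` E \<union> (\<Union>u\<in>U. conjugacy_class ?G ` Z n u))" for n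
  proof
    fix c assume "c \<in> {c \<in> ?C n. card (c \<inter> ?B n) < K}"
    then have c: "c \<in> ?C n" "card (c \<inter> ?B n) < K" by auto
    then have cc: "c \<in> conjugacy_classes ?G" by (auto simp: conjugacy_classes_ball_def)
    show "c \<in> ?C K \<union> (conjugacy_class ?G ` E \<union> (\<Union>u\<in>U. conjugacy_class ?G ` Z n u))"
    proof (cases "c \<in> ?C K")
      case False
      have "finite lamp_letters" by (simp add: lamp_letters_def)
      then obtain u g where u: "u \<in> ?B K" "u \<noteq> \<one>\<^bsub>?G\<^esub>" and g: "g \<in> c \<inter> ?B n"
        and comm: "u \<otimes>\<^bsub>?G\<^esub> g = g \<otimes>\<^bsub>?G\<^esub> u"
        using L.small_class_commutes[OF _ lamp_letters_closed c False] by blast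
      have ceq: "c = conjugacy_class ?G g"
        using L.conjugacy_class_of_mem[OF cc] g by blast
      show ?thesis
      proof (cases "snd u = 0")
        case True
        have "u \<in> carrier ?G" using u(1) by (simp add: word_ball_def)
        from commuting_with_base[OF this True u(2) comm] have g0: "g = (fst g, 0)"
          by (simp add: prod_eq_iff)
        have "\<bar>i\<bar> < int K" if "fst g i \<noteq> 0" for i
          using small_base_class_support[of c "fst g" n K i] cc c(2) that g g0 by simp
        then have "g \<in> E"
          using g g0 by (fastforce simp: E_def word_ball_def prod_eq_iff)
        then show ?thesis using ceq by blast
      next
        case False
        then have "u \<in> U" "g \<in> Z n u"
          using u g comm by (auto simp: U_def Z_def)
        then show ?thesis using ceq by blast
      qed
    qed simp
  qed
  \<comment> \<open>The three sizes in the factor are independent of \<open>n\<close>; the bounded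
    families are absorbed because \<open>2 * n + 1\<close> is at least 1.\<close>
  have "card {c \<in> ?C n. card (c \<inter> ?B n) < K} \<le> (card (?C K) + card E + card U) * (2 * n + 1)" for n
  proof -
    have "card (\<Union>u\<in>U. conjugacy_class ?G ` Z n u) \<le> (\<Sum>u\<in>U. card (conjugacy_class ?G ` Z n u))"
      by (rule card_UN_le[OF finU])
    also have "\<dots> \<le> (\<Sum>u\<in>U. 2 * n + 1)"
    proof (rule sum_mono)
      fix u assume "u \<in> U"
      then have "card (Z n u) \<le> 2 * n + 1"
        unfolding Z_def U_def by (intro card_centralizer_ball_le) simp
      then show "card (conjugacy_class ?G ` Z n u) \<le> 2 * n + 1"
        using card_image_le[OF finZ] order_trans by blast
    qed
    finally have "card (\<Union>u\<in>U. conjugacy_class ?G ` Z n u) \<le> card U * (2 * n + 1)"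
      by simp
    moreover have "card {c \<in> ?C n. card (c \<inter> ?B n) < K} \<le>
        card (?C K \<union> (conjugacy_class ?G ` E \<union> (\<Union>u\<in>U. conjugacy_class ?G ` Z n u)))"
      using finC finE finU finZ sub by (intro card_mono) auto
    moreover have "\<dots> \<le> card (?C K) +
        (card (conjugacy_class ?G ` E) + card (\<Union>u\<in>U. conjugacy_class ?G ` Z n u))"
      by (intro card_Un_le[THEN order_trans] add_left_mono card_Un_le)
    moreover have "card (conjugacy_class ?G ` E) \<le> card E"
      by (rule card_image_le[OF finE])
    ultimately show ?thesis
      by (simp add: algebra_simps)
  qed
  then show ?thesis by blast
qed

section \<open>Quadratic growth of the balls\<close>

lemma word_value_move:
  "word_value lamplighter_group (replicate i (\<lambda>_. 0, 1)) = (\<lambda>_. 0, int i)"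
  by (induction i) (simp_all add: one_lamplighter mult_lamplighter)

text \<open>Walk \<open>i\<close> steps, switch the lamp, walk \<open>j\<close> more steps: a word
  of length \<open>i + j + 1\<close>. The lit lamp recovers \<open>i\<close>, and the final position
  then recovers \<open>j\<close>.\<close>

lemma card_lamplighter_ball_ge:
  "(n div 2)\<^sup>2 \<le> card (word_ball lamplighter_group lamp_letters n)"
proof -
  define f :: "nat \<times> nat \<Rightarrow> _" where "f = (\<lambda>(i, j). (lamp (int i), int (i + j)))"
  have "f (i, j) \<in> word_ball lamplighter_group lamp_letters n" if "i < n div 2" "j < n div 2" for i j
  proof -
    let ?t = "(\<lambda>_. 0, 1) :: (int \<Rightarrow> int) \<times> int"
    let ?ws = "replicate i ?t @ ((lamp 0, 0) # replicate j ?t)"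
    have ws: "set ?ws \<subseteq> lamp_letters"
      by (auto simp: lamp_letters_def)
    then have "word_value lamplighter_group ?ws = f (i, j)"
      using lamplighter_word_closed[OF ws]
      by (subst L.word_value_append) (auto simp: word_value_move mult_lamplighter f_def lamp_def)
    moreover have "length ?ws \<le> n"
      using that by simp
    ultimately show ?thesis
      using ws unfolding lamplighter_ball_iff by blast
  qed
  then have "f ` ({..<n div 2} \<times> {..<n div 2}) \<subseteq> word_ball lamplighter_group lamp_letters n"
    by auto
  moreover have "inj f"
  proof (rule injI)
    fix x y assume eq: "f x = f y"
    then have "lamp (int (fst x)) (int (fst x)) = lamp (int (fst y)) (int (fst x))"
      by (simp add: f_def split_beta)
    then have "fst x = fst y"
      by (simp add: lamp_def split: if_splits)
    then show "x = y"
      using eq by (simp add: f_def split_beta prod_eq_iff)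
  qed
  ultimately have "card ({..<n div 2} \<times> {..<n div 2}) \<le> card (word_ball lamplighter_group lamp_letters n)"
    using finite_lamplighter_ball by (intro card_inj_on_le) (auto intro: inj_on_subset)
  then show ?thesis
    by (simp add: power2_eq_square)
qed

section \<open>Passage to the limit\<close>

lemma conjugacy_ratio_tendsto_0:
  "(\<lambda>n. real (card (conjugacy_classes_ball lamplighter_group lamp_letters n)) /
    real (card (word_ball lamplighter_group lamp_letters n))) \<longlonglongrightarrow> 0"
proof (rule LIMSEQ_I)
  fix e :: real assume e: "0 < e"
  let ?b = "\<lambda>n. card (word_ball lamplighter_group lamp_letters n)"
  let ?c = "\<lambda>n. card (conjugacy_classes_ball lamplighter_group lamp_letters n)"
  \<comment> \<open>One half of the factor \<open>e * K > 2\<close> pays for the large classes, the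
    other for the linear term of the small ones.\<close>
  obtain k where "2 / e < real k"
    using reals_Archimedean2 by blast
  moreover define K where "K = Suc k"
  ultimately have K: "2 < e * real K" "0 < K"
    using e by (auto simp: field_simps)
  obtain D where D: "\<And>n. card {c \<in> conjugacy_classes_ball lamplighter_group lamp_letters n.
      card (c \<inter> word_ball lamplighter_group lamp_letters n) < K} \<le> D * (2 * n + 1)"
    using card_small_classes_le[of K] by blast
  have fin: "finite lamp_letters"
    by (simp add: lamp_letters_def)
  have main: "real K * real (?c n) \<le> real (?b n) + real (K * D) * (2 * real n + 1)" for n
  proof -
    have "K * ?c n \<le> ?b n + K * (D * (2 * n + 1))"
      using L.card_conjugacy_classes_ball_le[OF fin lamp_letters_closed, where K = K and n = n]
        mult_le_mono2[OF D[of n], of K] by linarith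
    then have "real (K * ?c n) \<le> real (?b n + K * (D * (2 * n + 1)))"
      by (rule of_nat_mono)
    then show ?thesis by (simp add: algebra_simps)
  qed
  \<comment> \<open>The factor 20 generously covers the factor 7 arising below.\<close>
  obtain M where M: "real (K * D) * 20 < real M"
    using reals_Archimedean2 by blast
  show "\<exists>n0. \<forall>n\<ge>n0. norm (real (?c n) / real (?b n) - 0) < e"
  proof (intro exI allI impI)
    fix n assume n: "n \<ge> 2 * Suc M"
    define m where "m = n div 2"
    have m: "Suc M \<le> m" "n \<le> 2 * m + 1"
      using n by (auto simp: m_def)
    have bm: "real m * real m \<le> real (?b n)"
      using card_lamplighter_ball_ge[of n] unfolding m_def
      by (metis of_nat_le_iff of_nat_mult power2_eq_square)
    \<comment> \<open>Since \<open>n \<le> 2 * m + 1\<close> and \<open>m \<ge> 1\<close>, one has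
      \<open>2 * n + 1 \<le> 4 * m + 3 \<le> 7 * m\<close>.\<close>
    have "real (K * D) * (2 * real n + 1) \<le> real (K * D) * (7 * real m)"
      using m by (intro mult_left_mono) auto
    also have "\<dots> \<le> real M * real m"
      using M mult_right_mono[of "real (K * D) * 7" "real M" "real m"] by (simp add: mult.assoc)
    also have "\<dots> < real m * real m"
      using m by (intro mult_strict_right_mono) auto
    finally have "real K * real (?c n) < 2 * real (?b n)"
      using main[of n] bm by linarith
    also have "\<dots> \<le> e * real K * real (?b n)"
      using K by (intro mult_right_mono) auto
    finally have "real K * real (?c n) < real K * (e * real (?b n))"
      by (simp add: mult_ac)
    then have "real (?c n) < e * real (?b n)"
      using K(2) by simp
    moreover have "0 < real (?b n)"
    proof -
      have "0 < real m * real m" using m by simp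
      with bm show ?thesis by linarith
    qed
    ultimately show "norm (real (?c n) / real (?b n) - 0) < e"
      by (simp add: field_simps)
  qed
qed

theorem theorem4p3:
  fixes a t :: int
  assumes "a \<in> carrier (integer_mod_group 2)" and "a \<noteq> \<one>\<^bsub>integer_mod_group 2\<^esub>"
    and "generate integer_group {t} = carrier integer_group"
  shows "conjugacy_ratio lamplighter_group (lamplighter_gens a t) = 0"
proof -
  have "(\<lambda>n. ereal (real (card (conjugacy_classes_ball lamplighter_group lamp_letters n)) /
      real (card (word_ball lamplighter_group lamp_letters n)))) \<longlonglongrightarrow> ereal 0"
    using conjugacy_ratio_tendsto_0 by (intro tendsto_intros)
  \<comment> \<open>The ratios converge, so their upper limit is the limit.\<close>
  then show ?thesis
    unfolding conjugacy_ratio_def lamplighter_gens_eq[OF assms] zero_ereal_def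
    by (intro lim_imp_Limsup) simp_all
qed

end
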